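(* Let $n\ge k$ be positive integers, $f_k$ the $k$-clique Boolean function on $n$ vertices, and $X_k$ the set of the $\binom k2$ edge variables among some fixed set of $k$ vertices. If $f_k^{restricted}(X_k)=C_1\vee C_2\vee\dots\vee C_m$ is written in disjunctive normal form, then each clause $C_i$ ($1\le i\le m$) contains all of the variables in $X_k$.
   Context: The $k$-clique function $f_k$ takes as input a graph on vertex set $\{1,\dots,n\}$ encoded by $\binom n2$ bits $e_{ij}$ ($i<j$), $e_{ij}=1$ meaning the edge $\{i,j\}$ is present; $f_k=1$ iff the graph contains a clique on $k$ vertices. For a Boolean function $f$ and a subset $X$ of its variables, $f^{restricted}(X)$ denotes the Boolean function of the variables in $X$ obtained from $f$ by assigning the value $0$ to every variable not in $X$. A disjunctive normal form is a disjunction of clauses, each clause being a conjunction of literals (variables or negated variables).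
   Formalization: Clauses are assumed to contain no variable together with its negation; without this the claim fails, e.g. for n=k=3 with edge variables a, b, c the form (a∧b∧c)∨(a∧¬a) has a clause missing b and c. *)

theory Defs
  imports Main
begin

text \<open>
  A variable \<open>e\<^sub>i\<^sub>j\<close> with \<open>i < j\<close> is the pair \<open>(i, j)\<close>. A Boolean function is a predicate on total
  assignments, and a function of the variables in \<open>X\<close> is one that ignores the values outside \<open>X\<close>.
\<close>

type_synonym edge_var = "nat \<times> nat"
type_synonym 'v assignment = "'v \<Rightarrow> bool"
type_synonym 'v boolfun = "'v assignment \<Rightarrow> bool"

definition edge_vars :: "nat set \<Rightarrow> edge_var set" where
  "edge_vars V = {(i, j). i \<in> V \<and> j \<in> V \<and> i < j}"

definition clique_fun :: "nat \<Rightarrow> nat \<Rightarrow> edge_var boolfun" where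
  "clique_fun n k e \<longleftrightarrow>
     (\<exists>S \<subseteq> {1..n}. card S = k \<and> (\<forall>i\<in>S. \<forall>j\<in>S. i < j \<longrightarrow> e (i, j)))"

definition restricted :: "'v boolfun \<Rightarrow> 'v set \<Rightarrow> 'v boolfun" where
  "restricted f X a = f (\<lambda>x. if x \<in> X then a x else False)"

datatype 'v lit = Pos (var: 'v) | Neg (var: 'v)

fun lit_val :: "'v lit \<Rightarrow> 'v boolfun" where
  "lit_val (Pos x) a \<longleftrightarrow> a x"
| "lit_val (Neg x) a \<longleftrightarrow> \<not> a x"

type_synonym 'v clause = "'v lit set"

definition clause_val :: "'v clause \<Rightarrow> 'v boolfun" where
  "clause_val C a \<longleftrightarrow> (\<forall>l\<in>C. lit_val l a)"

definition dnf_val :: "'v clause list \<Rightarrow> 'v boolfun" where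
  "dnf_val Cs a \<longleftrightarrow> (\<exists>C\<in>set Cs. clause_val C a)"

text \<open>
  The usual convention on the clauses of a disjunctive normal form: no variable occurs together with
  its negation. Otherwise identically false clauses such as \<open>x \<and> \<not> x\<close> could be added to any
  disjunctive normal form without changing the function it represents.
\<close>

definition consistent :: "'v clause \<Rightarrow> bool" where
  "consistent C \<longleftrightarrow> (\<nexists>x. Pos x \<in> C \<and> Neg x \<in> C)"

definition dnf_over :: "'v set \<Rightarrow> 'v clause list \<Rightarrow> bool" where
  "dnf_over X Cs \<longleftrightarrow> (\<forall>C\<in>set Cs. finite C \<and> var ` C \<subseteq> X)"

end

theory Submission
  imports Defs
begin

text \<open>
  A clique on at least two vertices is determined by its edges, so for \<open>k \<ge> 2\<close> a graph all of whose
  edges join vertices of \<open>K\<close> can only have \<open>K\<close> itself as a \<open>k\<close>-clique: the restricted function is the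
  conjunction of all variables in \<open>edge_vars K\<close> (the empty one for \<open>k = 1\<close>). Each clause of a
  disjunctive normal form of it therefore implies all of these variables, and a consistent clause
  implies only the variables it contains, since making exactly its positive literals true satisfies it.
\<close>

lemma consistent_iff_clause_val_Pos:
  "consistent C \<longleftrightarrow> clause_val C (\<lambda>x. Pos x \<in> C)"
proof
  assume "consistent C"
  show "clause_val C (\<lambda>x. Pos x \<in> C)"
    unfolding clause_val_def
  proof
    fix l assume "l \<in> C"
    with \<open>consistent C\<close> show "lit_val l (\<lambda>x. Pos x \<in> C)"
      by (cases l) (auto simp: consistent_def)
  qed
next
  assume "clause_val C (\<lambda>x. Pos x \<in> C)"
  then show "consistent C"
    by (force simp: clause_val_def consistent_def)
qed

lemma Pos_mem_clause_iff:
  assumes "consistent C"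
  shows "Pos x \<in> C \<longleftrightarrow> (\<forall>a. clause_val C a \<longrightarrow> a x)"
proof
  assume "Pos x \<in> C"
  then show "\<forall>a. clause_val C a \<longrightarrow> a x"
    by (force simp: clause_val_def)
next
  assume "\<forall>a. clause_val C a \<longrightarrow> a x"
  then show "Pos x \<in> C"
    using assms consistent_iff_clause_val_Pos by blast
qed

lemma edge_vars_subset_imp_subset:
  assumes "edge_vars S \<subseteq> edge_vars V" and "card S \<noteq> 1"
  shows "S \<subseteq> V"
proof
  fix i assume "i \<in> S"
  with \<open>card S \<noteq> 1\<close> obtain j where "j \<in> S" "j \<noteq> i"
    by (metis is_singletonI' is_singleton_altdef empty_iff)
  then consider "(i, j) \<in> edge_vars S" | "(j, i) \<in> edge_vars S"
    using \<open>i \<in> S\<close> by (auto simp: edge_vars_def neq_iff)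
  then show "i \<in> V"
    using assms(1) by cases (auto simp: edge_vars_def)
qed

lemma edge_vars_eq_if_subset_card_eq:
  assumes "edge_vars S \<subseteq> edge_vars V" and "card S = card V" and "finite V"
  shows "edge_vars S = edge_vars V"
proof (cases "card V = 1")
  case True
  then have "edge_vars V = {}"
    by (auto simp: card_1_singleton_iff edge_vars_def)
  with assms(1) show ?thesis
    by simp
next
  case False
  with assms have "S \<subseteq> V"
    by (simp add: edge_vars_subset_imp_subset)
  with assms(2,3) have "S = V"
    by (simp add: card_subset_eq)
  then show ?thesis
    by simp
qed

lemma restricted_clique_fun_iff:
  "restricted (clique_fun n k) X a \<longleftrightarrow>
     (\<exists>S \<subseteq> {1..n}. card S = k \<and> edge_vars S \<subseteq> X \<and> (\<forall>x\<in>edge_vars S. a x))"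
proof -
  have "(\<forall>i\<in>S. \<forall>j\<in>S. i < j \<longrightarrow> (if (i, j) \<in> X then a (i, j) else False)) \<longleftrightarrow>
      edge_vars S \<subseteq> X \<and> (\<forall>x\<in>edge_vars S. a x)" for S
    by (auto simp: edge_vars_def)
  then show ?thesis
    by (simp add: restricted_def clique_fun_def)
qed

lemma restricted_clique_fun_eq_conjunction:
  assumes "K \<subseteq> {1..n}"
  shows "restricted (clique_fun n (card K)) (edge_vars K) = (\<lambda>a. \<forall>x\<in>edge_vars K. a x)"
proof (intro ext iffI)
  fix a assume "restricted (clique_fun n (card K)) (edge_vars K) a"
  then obtain S where "card S = card K" "edge_vars S \<subseteq> edge_vars K" "\<forall>x\<in>edge_vars S. a x"
    unfolding restricted_clique_fun_iff by blast
  moreover have "finite K"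
    using assms finite_subset by blast
  ultimately show "\<forall>x\<in>edge_vars K. a x"
    using edge_vars_eq_if_subset_card_eq by metis
next
  fix a assume "\<forall>x\<in>edge_vars K. a x"
  with assms show "restricted (clique_fun n (card K)) (edge_vars K) a"
    unfolding restricted_clique_fun_iff by blast
qed

theorem theorem2:
  fixes n k :: nat and K :: "nat set" and Cs :: "edge_var clause list"
  assumes "1 \<le> k" and "k \<le> n"
    and "K \<subseteq> {1..n}" and "card K = k"
    and "dnf_over (edge_vars K) Cs"
    and "\<forall>C\<in>set Cs. consistent C"
    and "restricted (clique_fun n k) (edge_vars K) = dnf_val Cs"
  shows "\<forall>i<length Cs. \<forall>x\<in>edge_vars K. Pos x \<in> Cs ! i"
proof (intro allI impI ballI)
  fix i x assume "i < length Cs" and "x \<in> edge_vars K"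
  then have clause_mem: "Cs ! i \<in> set Cs"
    by simp
  then have "consistent (Cs ! i)"
    using assms(6) by blast
  moreover have "\<forall>a. clause_val (Cs ! i) a \<longrightarrow> a x"
  proof (intro allI impI)
    fix a assume "clause_val (Cs ! i) a"
    then have "restricted (clique_fun n (card K)) (edge_vars K) a"
      using assms(4,7) clause_mem by (auto simp: dnf_val_def)
    then have "\<forall>x\<in>edge_vars K. a x"
      by (simp only: restricted_clique_fun_eq_conjunction[OF assms(3)])
    then show "a x"
      using \<open>x \<in> edge_vars K\<close> by (rule bspec)
  qed
  ultimately show "Pos x \<in> Cs ! i"
    by (simp only: Pos_mem_clause_iff)
qed

end
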